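(* Let $(X_i,Y_i)\in\mathbb{R}^p\times\mathbb{R}$, $i=1,\ldots,n$, be a sample, $\bar X=n^{-1}\sum_{i=1}^nX_i$, $\hat\Sigma=n^{-1}\sum_{i=1}^n(X_i-\bar X)(X_i-\bar X)^\top$ (invertible), and $Z_i=\hat\Sigma^{-1/2}(X_i-\bar X)$. Let $\tau\in(0,1)$, $\lambda>0$ and $\tilde\lambda=n^{-1}\lambda$. Consider the primal optimization problem $$\underset{\alpha\in\mathbb{R},\ \theta\in\mathbb{R}^p,\ \xi_{+},\xi_{-}\in\mathbb{R}^n}{\operatorname{min}}\ \ \theta^\top\theta+\tilde\lambda\tau\sum_{i=1}^n\xi_{i+}^2+\tilde\lambda(1-\tau)\sum_{i=1}^n\xi_{i-}^2$$ subject to, for all $i=1,\dots,n$, $\xi_{i+}\ge 0$, $\xi_{i-}\ge 0$, $\xi_{i+}\ge Y_i-\alpha-\theta^\top Z_i$, and $\xi_{i-}\ge\alpha+\theta^\top Z_i-Y_i$; let $(\hat\alpha_{0,\tau},\hat\theta_{0,\tau})$ be the $(\alpha,\theta)$-component of its minimizer. Let $\mathbb{Y}=(Y_1,\ldots,Y_n)^\top$ and let $\mathbb{Z}$ be the $n\times p$ matrix whose $i$th row is $Z_i^\top$. Then the dual optimization problem of the primal problem is $$(\hat a_{0,\tau},\hat\eta_{0,\tau})=\underset{a\in\mathbb{R}^n,\ \eta\in\mathbb{R}^n}{\operatorname{argmax}}\ (a-\eta)^\top\mathbb{Y}-\frac14(a-\eta)^\top\mathbb{Z}\mathbb{Z}^\top(a-\eta)-\frac{1}{4\tilde\lambda\tau}a^\top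 a-\frac{1}{4\tilde\lambda(1-\tau)}\eta^\top\eta$$ subject to $a\ge 0_n$, $\eta\ge 0_n$, and $(a-\eta)^\top 1_n=0$. Furthermore, $$\hat\theta_{0,\tau}=\frac12\,\mathbb{Z}^\top(\hat a_{0,\tau}-\hat\eta_{0,\tau}).$$
   Context: $0_n$ and $1_n$ are the vectors in $\mathbb{R}^n$ with all entries $0$ and $1$ respectively; vector inequalities are componentwise. "Dual" means the Lagrangian dual, where $a_i\ge 0$ is the multiplier of $\xi_{i+}\ge Y_i-\alpha-\theta^\top Z_i$, $\eta_i\ge 0$ is the multiplier of $\xi_{i-}\ge\alpha+\theta^\top Z_i-Y_i$, and the nonnegative multipliers $u_i,v_i$ of the constraints $\xi_{i+}\ge0$, $\xi_{i-}\ge0$ (which equal $0$ at the optimum) have been eliminated. *)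

theory Defs
  imports "HOL-Analysis.Analysis"
begin

text \<open>A sample of size \<open>n = CARD('n)\<close> in dimension \<open>p = CARD('p)\<close> is a matrix
  \<open>X :: real^'p^'n\<close> whose \<open>i\<close>-th row \<open>X $ i\<close> is the \<open>i\<close>-th observation.\<close>

definition sample_mean :: "real^'p^'n \<Rightarrow> real^'p" where
  "sample_mean X = (1 / real CARD('n)) *\<^sub>R (\<Sum>i\<in>UNIV. X $ i)"

definition outer_prod :: "real^'p \<Rightarrow> real^'p \<Rightarrow> real^'p^'p" where
  "outer_prod v w = (\<chi> j k. v $ j * w $ k)"

definition sample_cov :: "real^'p^'n \<Rightarrow> real^'p^'p" where
  "sample_cov X = (1 / real CARD('n)) *\<^sub>R
     (\<Sum>i\<in>UNIV. outer_prod (X $ i - sample_mean X) (X $ i - sample_mean X))"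

text \<open>The principal square root. It is well defined on symmetric positive semidefinite matrices,
  where exactly one symmetric positive semidefinite root exists.\<close>

definition mat_sqrt :: "real^'p^'p \<Rightarrow> real^'p^'p" where
  "mat_sqrt A = (THE S. transpose S = S \<and> (\<forall>x. 0 \<le> x \<bullet> (S *v x)) \<and> S ** S = A)"

definition standardized :: "real^'p^'n \<Rightarrow> real^'p^'n" where
  "standardized X =
     (\<chi> i. matrix_inv (mat_sqrt (sample_cov X)) *v (X $ i - sample_mean X))"

text \<open>A primal point is a tuple \<open>(\<alpha>, \<theta>, \<xi>p, \<xi>m)\<close>. The parameter \<open>l\<close> is the rescaled penalty
  \<open>\<lambda> / n\<close>.\<close>

type_synonym ('p, 'n) primal_point = "real \<times> (real^'p) \<times> (real^'n) \<times> (real^'n)"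

definition primal_objective ::
    "real \<Rightarrow> real \<Rightarrow> ('p::finite, 'n::finite) primal_point \<Rightarrow> real" where
  "primal_objective l \<tau> = (\<lambda>(\<alpha>, \<theta>, \<xi>p, \<xi>m).
     \<theta> \<bullet> \<theta> + l * \<tau> * (\<Sum>i\<in>UNIV. (\<xi>p $ i)\<^sup>2) + l * (1 - \<tau>) * (\<Sum>i\<in>UNIV. (\<xi>m $ i)\<^sup>2))"

definition primal_feasible ::
    "real^'p^'n \<Rightarrow> real^'n \<Rightarrow> ('p, 'n) primal_point \<Rightarrow> bool" where
  "primal_feasible Z Y = (\<lambda>(\<alpha>, \<theta>, \<xi>p, \<xi>m). \<forall>i.
     \<xi>p $ i \<ge> 0 \<and> \<xi>m $ i \<ge> 0 \<and>
     \<xi>p $ i \<ge> Y $ i - \<alpha> - \<theta> \<bullet> Z $ i \<and>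
     \<xi>m $ i \<ge> \<alpha> + \<theta> \<bullet> Z $ i - Y $ i)"

definition lagrangian ::
    "real \<Rightarrow> real \<Rightarrow> real^'p^'n \<Rightarrow> real^'n \<Rightarrow>
     real^'n \<Rightarrow> real^'n \<Rightarrow> real^'n \<Rightarrow> real^'n \<Rightarrow> ('p, 'n) primal_point \<Rightarrow> real" where
  "lagrangian l \<tau> Z Y a \<eta> u v = (\<lambda>(\<alpha>, \<theta>, \<xi>p, \<xi>m).
     primal_objective l \<tau> (\<alpha>, \<theta>, \<xi>p, \<xi>m)
     - (\<Sum>i\<in>UNIV. a $ i * (\<xi>p $ i - (Y $ i - \<alpha> - \<theta> \<bullet> Z $ i)))
     - (\<Sum>i\<in>UNIV. \<eta> $ i * (\<xi>m $ i - (\<alpha> + \<theta> \<bullet> Z $ i - Y $ i)))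
     - (\<Sum>i\<in>UNIV. u $ i * \<xi>p $ i)
     - (\<Sum>i\<in>UNIV. v $ i * \<xi>m $ i))"

text \<open>The infimum ranges over all primal points, feasible or not, and may be \<open>-\<infinity>\<close>.\<close>

definition lagrange_dual_fun ::
    "real \<Rightarrow> real \<Rightarrow> real^'p^'n \<Rightarrow> real^'n \<Rightarrow>
     real^'n \<Rightarrow> real^'n \<Rightarrow> real^'n \<Rightarrow> real^'n \<Rightarrow> ereal" where
  "lagrange_dual_fun l \<tau> Z Y a \<eta> u v = (INF x. ereal (lagrangian l \<tau> Z Y a \<eta> u v x))"

text \<open>On \<open>real^'n\<close> the order is componentwise, and \<open>0\<close> and \<open>1\<close> are the constant vectors.\<close>

definition is_lagrange_dual_solution ::
    "real \<Rightarrow> real \<Rightarrow> real^'p^'n \<Rightarrow> real^'n \<Rightarrow>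
     real^'n \<Rightarrow> real^'n \<Rightarrow> real^'n \<Rightarrow> real^'n \<Rightarrow> bool" where
  "is_lagrange_dual_solution l \<tau> Z Y a \<eta> u v \<longleftrightarrow>
     is_arg_max (\<lambda>(a, \<eta>, u, v). lagrange_dual_fun l \<tau> Z Y a \<eta> u v)
       (\<lambda>(a, \<eta>, u, v). 0 \<le> a \<and> 0 \<le> \<eta> \<and> 0 \<le> u \<and> 0 \<le> v) (a, \<eta>, u, v)"

definition dual_objective ::
    "real \<Rightarrow> real \<Rightarrow> real^'p^'n \<Rightarrow> real^'n \<Rightarrow> (real^'n) \<times> (real^'n) \<Rightarrow> real" where
  "dual_objective l \<tau> Z Y = (\<lambda>(a, \<eta>).
     (a - \<eta>) \<bullet> Y - 1 / 4 * ((a - \<eta>) \<bullet> ((Z ** transpose Z) *v (a - \<eta>)))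
     - 1 / (4 * l * \<tau>) * (a \<bullet> a) - 1 / (4 * l * (1 - \<tau>)) * (\<eta> \<bullet> \<eta>))"

definition dual_feasible :: "(real^'n) \<times> (real^'n) \<Rightarrow> bool" where
  "dual_feasible = (\<lambda>(a, \<eta>). 0 \<le> a \<and> 0 \<le> \<eta> \<and> (a - \<eta>) \<bullet> 1 = 0)"

end

theory Submission
  imports Defs
begin

text \<open>Completing the square in the Lagrangian writes it as the dual objective minus
  \<open>\<alpha> (a - \<eta>) \<bullet> 1\<close> plus three squares. This yields the dual function, and for feasible points it
  turns the duality gap into a sum of nonnegative terms. The gap vanishes for the pair built from a
  minimizer of the reduced objective in \<open>(\<alpha>, \<theta>)\<close>, which exists by coercivity and whose first order
  conditions are dual feasibility and \<open>\<theta> = \<onehalf> Z\<^sup>T (a - \<eta>)\<close>. Every optimal pair then has zero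
  gap, so all the squares vanish, and uniqueness and the formula for \<open>\<theta>\<close> follow.\<close>

section \<open>Residuals and elementary inequalities\<close>

definition residual :: "real^'p^'n \<Rightarrow> real^'n \<Rightarrow> real \<Rightarrow> real^'p \<Rightarrow> real^'n" where
  "residual Z Y \<alpha> \<theta> = (\<chi> i. Y $ i - \<alpha> - \<theta> \<bullet> Z $ i)"

definition pos_part :: "real^'n \<Rightarrow> real^'n" where
  "pos_part x = (\<chi> i. max 0 (x $ i))"

text \<open>The residual is affine in \<open>\<alpha>\<close> and \<open>\<theta>\<close>; pairing
  it with \<open>b = a - \<eta>\<close> exposes their coefficients in the Lagrangian.\<close>

lemma inner_residual:
  "b \<bullet> residual Z Y \<alpha> \<theta> = b \<bullet> Y - \<alpha> * (b \<bullet> 1) - \<theta> \<bullet> (transpose Z *v b)"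
proof -
  have "residual Z Y \<alpha> \<theta> = Y - \<alpha> *\<^sub>R 1 - Z *v \<theta>"
    by (simp add: residual_def vec_eq_iff matrix_vector_mul_component inner_commute)
  moreover have "b \<bullet> (Z *v \<theta>) = \<theta> \<bullet> (transpose Z *v b)"
    by (metis dot_lmul_matrix inner_commute transpose_matrix_vector)
  ultimately show ?thesis
    by (simp add: inner_diff_right)
qed

lemma residual_add:
  "residual Z Y (\<alpha> + s) (\<theta> + \<phi>) $ i = residual Z Y \<alpha> \<theta> $ i - (s + \<phi> \<bullet> Z $ i)"
  by (simp add: residual_def inner_add_left)

text \<open>Completing the square: \<open>c * (x \<bullet> x) - x \<bullet> y\<close> is least at
  \<open>x = y / (2c)\<close>. Each quadratic term of the dual objective arises this way.\<close>

lemma scaled_norm_diff_square: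
  fixes x y :: "'a::real_inner"
  assumes "c > 0"
  shows "c * (norm (x - (1 / (2 * c)) *\<^sub>R y))\<^sup>2 = c * (x \<bullet> x) - x \<bullet> y + 1 / (4 * c) * (y \<bullet> y)"
  using assms unfolding power2_norm_eq_inner
  by (simp add: inner_diff_left inner_diff_right inner_commute field_simps)

text \<open>The right-hand side is the square of \<open>max 0 x + h\<close>. This is the quadratic
  upper bound for a function with derivative \<open>2 * max 0 x\<close>, and it replaces
  differentiation later on.\<close>

lemma pos_part_square_add_le:
  fixes x h :: real
  shows "(max 0 (x + h))\<^sup>2 \<le> (max 0 x)\<^sup>2 + 2 * max 0 x * h + h\<^sup>2"
proof (cases "x + h \<ge> 0")
  case True
  have "(x + h)\<^sup>2 \<le> (max 0 x + h)\<^sup>2"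
    using True by (intro power_mono) auto
  then show ?thesis
    using True by (simp add: power2_eq_square algebra_simps)
next
  case False
  have "0 \<le> (max 0 x + h)\<^sup>2" by simp
  then show ?thesis
    using False by (simp add: power2_eq_square algebra_simps)
qed

text \<open>Fermat's condition: the quadratic vanishes at \<open>t = 0\<close>, so it has its
  minimum there and its slope \<open>k\<close> must be zero.\<close>

lemma linear_coefficient_zero:
  fixes k K :: real
  assumes "\<And>t. 0 \<le> t * k + t\<^sup>2 * K"
  shows "k = 0"
proof (rule ccontr)
  assume "k \<noteq> 0"
  define J where "J = \<bar>K\<bar> + 1"
  \<comment> \<open>The minimizer of \<open>t * k + t\<^sup>2 * J\<close>; passing from
    \<open>K\<close> to the positive bound \<open>J\<close> makes the division legitimate for every
    sign of \<open>K\<close>.\<close>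
  define t where "t = - k / (2 * J)"
  have J: "0 < J" "K \<le> J"
    by (auto simp: J_def)
  have "t * k + t\<^sup>2 * K \<le> t * k + t\<^sup>2 * J"
    using J by (intro add_left_mono mult_left_mono) auto
  also have "\<dots> = - k\<^sup>2 / (4 * J)"
    using J unfolding t_def by (simp add: field_simps power2_eq_square)
  also have "\<dots> < 0"
    using \<open>k \<noteq> 0\<close> J by (simp add: divide_neg_pos)
  finally show False
    using assms[of t] by simp
qed

section \<open>The Lagrangian and its dual function\<close>

locale asymmetric_least_squares =
  fixes l \<tau> :: real and Z :: "real^'p^'n" and Y :: "real^'n"
  assumes l_pos: "0 < l" and \<tau>_pos: "0 < \<tau>" and \<tau>_less_1: "\<tau> < 1"
begin

abbreviation "P \<equiv> primal_objective l \<tau> :: ('p, 'n) primal_point \<Rightarrow> real"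
abbreviation "D \<equiv> dual_objective l \<tau> Z Y"

lemma weights_pos: "0 < l * \<tau>" "0 < l * (1 - \<tau>)"
  using l_pos \<tau>_pos \<tau>_less_1 by auto

lemma P_inner: "P (\<alpha>, \<theta>, \<xi>p, \<xi>m) = \<theta> \<bullet> \<theta> + l * \<tau> * (\<xi>p \<bullet> \<xi>p) + l * (1 - \<tau>) * (\<xi>m \<bullet> \<xi>m)"
  by (simp add: primal_objective_def inner_vec_def power2_eq_square)

lemma lagrangian_inner:
  "lagrangian l \<tau> Z Y a \<eta> u v (\<alpha>, \<theta>, \<xi>p, \<xi>m) =
    P (\<alpha>, \<theta>, \<xi>p, \<xi>m) - a \<bullet> (\<xi>p - residual Z Y \<alpha> \<theta>) - \<eta> \<bullet> (\<xi>m + residual Z Y \<alpha> \<theta>)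
    - u \<bullet> \<xi>p - v \<bullet> \<xi>m"
proof -
  have "\<xi>m $ i - (\<alpha> + \<theta> \<bullet> Z $ i - Y $ i) = (\<xi>m + residual Z Y \<alpha> \<theta>) $ i"
       "\<xi>p $ i - (Y $ i - \<alpha> - \<theta> \<bullet> Z $ i) = (\<xi>p - residual Z Y \<alpha> \<theta>) $ i" for i
    by (auto simp: residual_def)
  then show ?thesis
    unfolding lagrangian_def case_prod_conv
    by (simp only: inner_vec_def[of a] inner_vec_def[of \<eta>] inner_vec_def[of u] inner_vec_def[of v]
        inner_real_def)
qed

text \<open>What remains of the Lagrangian on the hyperplane
  \<open>(a - \<eta>) \<bullet> 1 = 0\<close> once its three squares vanish, with \<open>u\<close>
  and \<open>v\<close> not yet eliminated. Both \<open>a\<close> and \<open>u\<close> multiply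
  \<open>\<xi>p\<close>, so the quadratic term sees only their sum; likewise for
  \<open>\<eta>\<close> and \<open>v\<close>.\<close>

definition penalized_dual :: "real^'n \<Rightarrow> real^'n \<Rightarrow> real^'n \<Rightarrow> real^'n \<Rightarrow> real" where
  "penalized_dual a \<eta> u v = (a - \<eta>) \<bullet> Y
     - 1 / 4 * ((transpose Z *v (a - \<eta>)) \<bullet> (transpose Z *v (a - \<eta>)))
     - 1 / (4 * (l * \<tau>)) * ((a + u) \<bullet> (a + u))
     - 1 / (4 * (l * (1 - \<tau>))) * ((\<eta> + v) \<bullet> (\<eta> + v))"

lemma penalized_dual_0: "penalized_dual a \<eta> 0 0 = D (a, \<eta>)"
proof -
  have "b \<bullet> ((Z ** transpose Z) *v b) = (transpose Z *v b) \<bullet> (transpose Z *v b)" for b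
    by (metis dot_lmul_matrix matrix_vector_mul_assoc transpose_matrix_vector)
  then show ?thesis
    by (simp add: penalized_dual_def dual_objective_def mult.assoc)
qed

text \<open>The Lagrangian is affine in \<open>\<alpha>\<close> and separately quadratic in
  \<open>\<theta>\<close>, \<open>\<xi>p\<close>, \<open>\<xi>m\<close>, with weights
  \<open>1\<close>, \<open>l * \<tau>\<close>, \<open>l * (1 - \<tau>)\<close>; the square is
  completed in each.\<close>

lemma lagrangian_squares:
  "lagrangian l \<tau> Z Y a \<eta> u v (\<alpha>, \<theta>, \<xi>p, \<xi>m) =
     penalized_dual a \<eta> u v - \<alpha> * ((a - \<eta>) \<bullet> 1)
     + (norm (\<theta> - (1 / 2) *\<^sub>R (transpose Z *v (a - \<eta>))))\<^sup>2
     + l * \<tau> * (norm (\<xi>p - (1 / (2 * (l * \<tau>))) *\<^sub>R (a + u)))\<^sup>2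
     + l * (1 - \<tau>) * (norm (\<xi>m - (1 / (2 * (l * (1 - \<tau>)))) *\<^sub>R (\<eta> + v)))\<^sup>2"
proof -
  let ?r = "residual Z Y \<alpha> \<theta>"
  have "a \<bullet> (\<xi>p - ?r) + \<eta> \<bullet> (\<xi>m + ?r) = a \<bullet> \<xi>p + \<eta> \<bullet> \<xi>m - (a - \<eta>) \<bullet> ?r"
    by (simp add: inner_diff_right inner_add_right inner_diff_left)
  then show ?thesis
    unfolding lagrangian_inner P_inner penalized_dual_def
      scaled_norm_diff_square[OF weights_pos(1)] scaled_norm_diff_square[OF weights_pos(2)]
      inner_residual
    using scaled_norm_diff_square[of 1 \<theta> "transpose Z *v (a - \<eta>)"]
    by (simp add: inner_residual inner_add_right inner_commute)
qed

lemma lagrange_dual_fun_eq: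
  "lagrange_dual_fun l \<tau> Z Y a \<eta> u v =
    (if (a - \<eta>) \<bullet> 1 = 0 then ereal (penalized_dual a \<eta> u v) else - \<infinity>)"
proof (cases "(a - \<eta>) \<bullet> 1 = 0")
  case True
  have "lagrange_dual_fun l \<tau> Z Y a \<eta> u v = ereal (penalized_dual a \<eta> u v)"
    unfolding lagrange_dual_fun_def
  proof (rule antisym)
    show "(INF x. ereal (lagrangian l \<tau> Z Y a \<eta> u v x)) \<le> ereal (penalized_dual a \<eta> u v)"
      \<comment> \<open>The witness puts each block at the centre of its square; its
        \<open>\<alpha>\<close> is arbitrary because the coefficient of \<open>\<alpha>\<close>
        vanishes.\<close>
      by (rule INF_lower2[of "(0, (1 / 2) *\<^sub>R (transpose Z *v (a - \<eta>)),
            (1 / (2 * (l * \<tau>))) *\<^sub>R (a + u), (1 / (2 * (l * (1 - \<tau>)))) *\<^sub>R (\<eta> + v))"])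
        (simp_all add: lagrangian_squares)
    show "ereal (penalized_dual a \<eta> u v) \<le> (INF x. ereal (lagrangian l \<tau> Z Y a \<eta> u v x))"
    proof (rule INF_greatest)
      fix x :: "('p, 'n) primal_point"
      obtain \<alpha> \<theta> \<xi>p \<xi>m where x: "x = (\<alpha>, \<theta>, \<xi>p, \<xi>m)"
        by (metis prod.exhaust)
      show "ereal (penalized_dual a \<eta> u v) \<le> ereal (lagrangian l \<tau> Z Y a \<eta> u v x)"
        unfolding x lagrangian_squares using weights_pos True by simp
    qed
  qed
  then show ?thesis using True by simp
next
  case False
  define k where "k = (a - \<eta>) \<bullet> 1"
  define K where "K = lagrangian l \<tau> Z Y a \<eta> u v (0, 0, 0, 0)"
  have L: "lagrangian l \<tau> Z Y a \<eta> u v (\<alpha>, 0, 0, 0) = K - \<alpha> * k" for \<alpha>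
    by (simp add: K_def k_def lagrangian_squares)
  \<comment> \<open>The Lagrangian is unbounded below in the free variable \<open>\<alpha>\<close>:
    the choice \<open>(K - B) / k\<close> gives it exactly the value \<open>B\<close>.\<close>
  have "lagrange_dual_fun l \<tau> Z Y a \<eta> u v \<le> ereal B" for B
    unfolding lagrange_dual_fun_def
    by (rule INF_lower2[of "((K - B) / k, 0, 0, 0)"])
      (use False in \<open>simp_all add: L k_def[symmetric]\<close>)
  then show ?thesis
    using False by (simp add: ereal_bot)
qed

text \<open>Dropping \<open>u\<close> gains a positive multiple of
  \<open>2 * (a \<bullet> u) + u \<bullet> u\<close>, which is nonnegative for \<open>a\<close>,
  \<open>u\<close> in the orthant and zero only at \<open>u = 0\<close>; the same holds for
  \<open>v\<close>.\<close>

lemma penalized_dual_le: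
  assumes "0 \<le> a" "0 \<le> \<eta>" "0 \<le> u" "0 \<le> v"
  shows "penalized_dual a \<eta> u v \<le> D (a, \<eta>)"
    and "penalized_dual a \<eta> u v = D (a, \<eta>) \<Longrightarrow> u = 0 \<and> v = 0"
proof -
  have nonneg: "0 \<le> x \<bullet> y" if "0 \<le> x" "0 \<le> y" for x y :: "real^'n"
    using that by (simp add: inner_vec_def less_eq_vec_def sum_nonneg)
  define s t where "s = 1 / (4 * (l * \<tau>))" and "t = 1 / (4 * (l * (1 - \<tau>)))"
  have st: "0 < s" "0 < t"
    unfolding s_def t_def using weights_pos by auto
  have eq: "D (a, \<eta>) = penalized_dual a \<eta> u v + s * (2 * (a \<bullet> u) + u \<bullet> u)
      + t * (2 * (\<eta> \<bullet> v) + v \<bullet> v)"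
    unfolding penalized_dual_0[symmetric] penalized_dual_def s_def[symmetric] t_def[symmetric]
    by (simp add: inner_add_left inner_add_right inner_commute algebra_simps)
  have *: "0 \<le> s * (2 * (a \<bullet> u) + u \<bullet> u)" "0 \<le> t * (2 * (\<eta> \<bullet> v) + v \<bullet> v)"
    using st nonneg[of a u] nonneg[of \<eta> v] assms by auto
  show "penalized_dual a \<eta> u v \<le> D (a, \<eta>)"
    using eq * by linarith
  assume "penalized_dual a \<eta> u v = D (a, \<eta>)"
  then have "s * (2 * (a \<bullet> u) + u \<bullet> u) = 0" "t * (2 * (\<eta> \<bullet> v) + v \<bullet> v) = 0"
    using eq * by linarith+
  then have "2 * (a \<bullet> u) + u \<bullet> u = 0" "2 * (\<eta> \<bullet> v) + v \<bullet> v = 0"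
    using st by auto
  then have "u \<bullet> u = 0" "v \<bullet> v = 0"
    using nonneg[of a u] nonneg[of \<eta> v] assms inner_ge_zero[of u] inner_ge_zero[of v]
    by linarith+
  then show "u = 0 \<and> v = 0" by simp
qed

text \<open>Elimination of \<open>u\<close> and \<open>v\<close> by partial maximization: the
  supremum is attained at \<open>u = v = 0\<close>.\<close>

lemma SUP_lagrange_dual_fun:
  assumes "0 \<le> a" "0 \<le> \<eta>"
  shows "(SUP (u, v)\<in>{(u, v). 0 \<le> u \<and> 0 \<le> v}. lagrange_dual_fun l \<tau> Z Y a \<eta> u v) =
    (if (a - \<eta>) \<bullet> 1 = 0 then ereal (D (a, \<eta>)) else - \<infinity>)"
proof (rule antisym)
  show "(SUP (u, v)\<in>{(u, v). 0 \<le> u \<and> 0 \<le> v}. lagrange_dual_fun l \<tau> Z Y a \<eta> u v) \<le>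
    (if (a - \<eta>) \<bullet> 1 = 0 then ereal (D (a, \<eta>)) else - \<infinity>)"
    by (rule SUP_least) (use penalized_dual_le(1)[OF assms] in \<open>auto simp: lagrange_dual_fun_eq\<close>)
  show "(if (a - \<eta>) \<bullet> 1 = 0 then ereal (D (a, \<eta>)) else - \<infinity>) \<le>
    (SUP (u, v)\<in>{(u, v). 0 \<le> u \<and> 0 \<le> v}. lagrange_dual_fun l \<tau> Z Y a \<eta> u v)"
    by (rule SUP_upper2[of "(0, 0)"]) (auto simp: lagrange_dual_fun_eq penalized_dual_0)
qed

lemma is_lagrange_dual_solution_iff:
  "is_lagrange_dual_solution l \<tau> Z Y a \<eta> u v \<longleftrightarrow>
    u = 0 \<and> v = 0 \<and> is_arg_max D dual_feasible (a, \<eta>)"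
proof
  assume sol: "is_lagrange_dual_solution l \<tau> Z Y a \<eta> u v"
  then have nonneg: "0 \<le> a" "0 \<le> \<eta>" "0 \<le> u" "0 \<le> v"
    and max: "\<And>a' \<eta>'. 0 \<le> a' \<Longrightarrow> 0 \<le> \<eta>' \<Longrightarrow>
      lagrange_dual_fun l \<tau> Z Y a' \<eta>' 0 0 \<le> lagrange_dual_fun l \<tau> Z Y a \<eta> u v"
    by (auto simp: is_lagrange_dual_solution_def is_arg_max_linorder)
  \<comment> \<open>The dual function is finite at the origin, so a maximizer cannot have the value
    \<open>-\<infinity>\<close>.\<close>
  have bal: "(a - \<eta>) \<bullet> 1 = 0"
    using max[of 0 0] by (auto simp: lagrange_dual_fun_eq split: if_splits)
  have max': "D (a', \<eta>') \<le> penalized_dual a \<eta> u v" if "dual_feasible (a', \<eta>')" for a' \<eta>'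
    using max[of a' \<eta>'] that bal
    by (auto simp: lagrange_dual_fun_eq dual_feasible_def penalized_dual_0)
  have feas: "dual_feasible (a, \<eta>)"
    using nonneg bal by (simp add: dual_feasible_def)
  \<comment> \<open>Comparison with \<open>(a, \<eta>, 0, 0)\<close> gives one inequality,
    \<open>penalized_dual_le\<close> the other; equality then forces
    \<open>u = v = 0\<close>.\<close>
  have "penalized_dual a \<eta> u v = D (a, \<eta>)"
    using max'[OF feas] penalized_dual_le(1)[OF nonneg] by simp
  with penalized_dual_le(2)[OF nonneg this] feas max'
  show "u = 0 \<and> v = 0 \<and> is_arg_max D dual_feasible (a, \<eta>)"
    by (auto simp: is_arg_max_linorder)
next
  assume *: "u = 0 \<and> v = 0 \<and> is_arg_max D dual_feasible (a, \<eta>)"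
  then have feas: "0 \<le> a" "0 \<le> \<eta>" "(a - \<eta>) \<bullet> 1 = 0"
    by (auto simp: is_arg_max_linorder dual_feasible_def)
  have "lagrange_dual_fun l \<tau> Z Y a' \<eta>' u' v' \<le> ereal (D (a, \<eta>))"
    if nonneg: "0 \<le> a'" "0 \<le> \<eta>'" "0 \<le> u'" "0 \<le> v'" for a' \<eta>' u' v'
  proof (cases "(a' - \<eta>') \<bullet> 1 = 0")
    case True
    then have "D (a', \<eta>') \<le> D (a, \<eta>)"
      using * nonneg by (auto simp: is_arg_max_linorder dual_feasible_def)
    then show ?thesis
      using penalized_dual_le(1)[OF nonneg] True by (simp add: lagrange_dual_fun_eq)
  qed (simp add: lagrange_dual_fun_eq)
  then show "is_lagrange_dual_solution l \<tau> Z Y a \<eta> u v"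
    using * feas
    by (auto simp: is_lagrange_dual_solution_def is_arg_max_linorder lagrange_dual_fun_eq
        penalized_dual_0)
qed

section \<open>Duality gap and weak duality\<close>

text \<open>At \<open>u = v = 0\<close> the two expressions for the Lagrangian are equated; the sums
  at the end are the complementary slackness terms.\<close>

lemma duality_gap:
  assumes "dual_feasible (a, \<eta>)"
  shows "P (\<alpha>, \<theta>, \<xi>p, \<xi>m) = D (a, \<eta>)
     + (norm (\<theta> - (1 / 2) *\<^sub>R (transpose Z *v (a - \<eta>))))\<^sup>2
     + l * \<tau> * (norm (\<xi>p - (1 / (2 * (l * \<tau>))) *\<^sub>R a))\<^sup>2
     + l * (1 - \<tau>) * (norm (\<xi>m - (1 / (2 * (l * (1 - \<tau>)))) *\<^sub>R \<eta>))\<^sup>2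
     + (\<Sum>i\<in>UNIV. a $ i * (\<xi>p $ i - residual Z Y \<alpha> \<theta> $ i))
     + (\<Sum>i\<in>UNIV. \<eta> $ i * (\<xi>m $ i + residual Z Y \<alpha> \<theta> $ i))"
  using lagrangian_squares[of a \<eta> 0 0 \<alpha> \<theta> \<xi>p \<xi>m] lagrangian_inner[of a \<eta> 0 0 \<alpha> \<theta> \<xi>p \<xi>m] assms
  by (simp add: dual_feasible_def penalized_dual_0 inner_vec_def)

lemma primal_feasible_iff:
  "primal_feasible Z Y (\<alpha>, \<theta>, \<xi>p, \<xi>m) \<longleftrightarrow> (\<forall>i. 0 \<le> \<xi>p $ i \<and> 0 \<le> \<xi>m $ i \<and>
     0 \<le> \<xi>p $ i - residual Z Y \<alpha> \<theta> $ i \<and> 0 \<le> \<xi>m $ i + residual Z Y \<alpha> \<theta> $ i)"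
  by (auto simp: primal_feasible_def residual_def algebra_simps)

text \<open>Every term of the gap is nonnegative at feasible points. A zero gap therefore kills each
  of them, which gives stationarity and complementary slackness.\<close>

lemma weak_duality:
  assumes w: "primal_feasible Z Y (\<alpha>, \<theta>, \<xi>p, \<xi>m)" and d: "dual_feasible (a, \<eta>)"
  shows "D (a, \<eta>) \<le> P (\<alpha>, \<theta>, \<xi>p, \<xi>m)"
    and "P (\<alpha>, \<theta>, \<xi>p, \<xi>m) = D (a, \<eta>) \<Longrightarrow>
      \<theta> = (1 / 2) *\<^sub>R (transpose Z *v (a - \<eta>)) \<and>
      a = (2 * (l * \<tau>)) *\<^sub>R \<xi>p \<and> \<eta> = (2 * (l * (1 - \<tau>))) *\<^sub>R \<xi>m \<and>
      (\<forall>i. a $ i * (\<xi>p $ i - residual Z Y \<alpha> \<theta> $ i) = 0 \<and>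
           \<eta> $ i * (\<xi>m $ i + residual Z Y \<alpha> \<theta> $ i) = 0)"
proof -
  define A where "A = (norm (\<theta> - (1 / 2) *\<^sub>R (transpose Z *v (a - \<eta>))))\<^sup>2"
  define B where "B = l * \<tau> * (norm (\<xi>p - (1 / (2 * (l * \<tau>))) *\<^sub>R a))\<^sup>2"
  define C where "C = l * (1 - \<tau>) * (norm (\<xi>m - (1 / (2 * (l * (1 - \<tau>)))) *\<^sub>R \<eta>))\<^sup>2"
  let ?S = "\<lambda>i. a $ i * (\<xi>p $ i - residual Z Y \<alpha> \<theta> $ i)"
  let ?T = "\<lambda>i. \<eta> $ i * (\<xi>m $ i + residual Z Y \<alpha> \<theta> $ i)"
  have gap: "P (\<alpha>, \<theta>, \<xi>p, \<xi>m) = D (a, \<eta>) + A + B + C + sum ?S UNIV + sum ?T UNIV"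
    unfolding A_def B_def C_def by (rule duality_gap[OF d])
  have ABC: "0 \<le> A" "0 \<le> B" "0 \<le> C"
    unfolding A_def B_def C_def using weights_pos by auto
  have terms: "0 \<le> ?S i" "0 \<le> ?T i" for i
    using w d
    by (auto simp: primal_feasible_iff dual_feasible_def less_eq_vec_def intro!: mult_nonneg_nonneg)
  then have ST: "0 \<le> sum ?S UNIV" "0 \<le> sum ?T UNIV"
    by (simp_all add: sum_nonneg)
  show "D (a, \<eta>) \<le> P (\<alpha>, \<theta>, \<xi>p, \<xi>m)"
    using gap ABC ST by linarith
  assume "P (\<alpha>, \<theta>, \<xi>p, \<xi>m) = D (a, \<eta>)"
  then have zero: "A = 0" "B = 0" "C = 0" "sum ?S UNIV = 0" "sum ?T UNIV = 0"
    using gap ABC ST by linarith+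
  then have "\<theta> = (1 / 2) *\<^sub>R (transpose Z *v (a - \<eta>))"
    and "\<xi>p = (1 / (2 * (l * \<tau>))) *\<^sub>R a" and "\<xi>m = (1 / (2 * (l * (1 - \<tau>)))) *\<^sub>R \<eta>"
    using l_pos \<tau>_pos \<tau>_less_1 unfolding A_def B_def C_def by simp_all
  moreover have "?S i = 0 \<and> ?T i = 0" for i
    using zero(4,5) terms by (simp add: sum_nonneg_eq_0_iff)
  ultimately show "\<theta> = (1 / 2) *\<^sub>R (transpose Z *v (a - \<eta>)) \<and>
      a = (2 * (l * \<tau>)) *\<^sub>R \<xi>p \<and> \<eta> = (2 * (l * (1 - \<tau>))) *\<^sub>R \<xi>m \<and>
      (\<forall>i. ?S i = 0 \<and> ?T i = 0)"
    using weights_pos by auto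
qed

section \<open>Existence of an optimal pair through the reduced problem\<close>

text \<open>The primal objective after optimizing the slacks for fixed
  \<open>(\<alpha>, \<theta>)\<close>: ridge-penalized expectile regression.\<close>

definition reduced_objective :: "real \<times> (real^'p) \<Rightarrow> real" where
  "reduced_objective x = snd x \<bullet> snd x + (\<Sum>i\<in>UNIV.
     l * \<tau> * (max 0 (residual Z Y (fst x) (snd x) $ i))\<^sup>2
     + l * (1 - \<tau>) * (max 0 (- residual Z Y (fst x) (snd x) $ i))\<^sup>2)"

text \<open>The penalty bounds \<open>\<theta>\<close>; a bound on one single residual then bounds
  \<open>\<alpha>\<close>.\<close>

lemma bounded_reduced_objective_sublevel: "bounded {x. reduced_objective x \<le> C}"
proof -
  \<comment> \<open>The smaller weight, so that the loss dominates \<open>m\<close> times the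
    squared residual whatever its sign.\<close>
  define m where "m = min (l * \<tau>) (l * (1 - \<tau>))"
  have m: "0 < m"
    unfolding m_def using weights_pos by simp
  fix i :: 'n
  have "norm x \<le> \<bar>Y $ i\<bar> + sqrt C * norm (Z $ i) + sqrt (C / m) + sqrt C"
    if x: "reduced_objective x \<le> C" for x
  proof -
    define r where "r = residual Z Y (fst x) (snd x)"
    let ?q = "\<lambda>j. l * \<tau> * (max 0 (r $ j))\<^sup>2 + l * (1 - \<tau>) * (max 0 (- r $ j))\<^sup>2"
    have q: "m * (r $ j)\<^sup>2 \<le> ?q j" for j
      unfolding m_def by (cases "0 \<le> r $ j") (auto simp: max_def intro!: mult_right_mono)
    have q0: "0 \<le> ?q j" for j
      using weights_pos by simp
    have "?q i \<le> sum ?q UNIV"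
      using q0 by (intro member_le_sum) auto
    moreover have "snd x \<bullet> snd x + sum ?q UNIV \<le> C"
      using x unfolding reduced_objective_def r_def .
    moreover have "0 \<le> sum ?q UNIV"
      using q0 by (intro sum_nonneg) auto
    ultimately have \<theta>: "(norm (snd x))\<^sup>2 \<le> C" and ri: "m * (r $ i)\<^sup>2 \<le> C"
      using q[of i] inner_ge_zero[of "snd x"] unfolding power2_norm_eq_inner by linarith+
    have \<theta>': "norm (snd x) \<le> sqrt C"
      using \<theta> by (rule real_le_rsqrt)
    have "(r $ i)\<^sup>2 \<le> C / m"
      using ri m by (simp add: field_simps)
    then have ri': "\<bar>r $ i\<bar> \<le> sqrt (C / m)"
      by (intro real_le_rsqrt) simp
    have "fst x = Y $ i - snd x \<bullet> Z $ i - r $ i"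
      by (simp add: r_def residual_def)
    then have "\<bar>fst x\<bar> \<le> \<bar>Y $ i\<bar> + \<bar>snd x \<bullet> Z $ i\<bar> + \<bar>r $ i\<bar>"
      by linarith
    moreover have "\<bar>snd x \<bullet> Z $ i\<bar> \<le> sqrt C * norm (Z $ i)"
      using Cauchy_Schwarz_ineq2 mult_right_mono[OF \<theta>' norm_ge_zero] by (rule order_trans)
    moreover have "norm x \<le> \<bar>fst x\<bar> + norm (snd x)"
      using norm_Pair_le[of "fst x" "snd x"] by simp
    ultimately show ?thesis
      using ri' \<theta>' by linarith
  qed
  then show ?thesis
    unfolding bounded_iff by blast
qed

text \<open>A continuous function attains its minimum on the compact sublevel set through the
  origin, and every point outside that set has a larger value.\<close>

lemma reduced_minimizer_exists:
  obtains x where "\<And>y. reduced_objective x \<le> reduced_objective y"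
proof -
  let ?S = "{x. reduced_objective x \<le> reduced_objective (0, 0)}"
  have cont: "continuous_on S reduced_objective" for S
    unfolding reduced_objective_def[abs_def] residual_def vec_lambda_beta
    by (intro continuous_intros)
  have "closed ?S"
    by (intro closed_Collect_le cont continuous_on_const)
  then have "compact ?S"
    using bounded_reduced_objective_sublevel by (simp add: compact_eq_bounded_closed)
  moreover have "(0, 0) \<in> ?S" by simp
  ultimately obtain x where x: "x \<in> ?S" "\<forall>y\<in>?S. reduced_objective x \<le> reduced_objective y"
    using continuous_attains_inf[OF _ _ cont, of ?S] by blast
  have "reduced_objective x \<le> reduced_objective y" for y
    by (metis x mem_Collect_eq linear order_trans)
  then show thesis
    by (rule that)
qed

text \<open>First-order expansion with a quadratic remainder. The vector \<open>b\<close> is the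
  gradient of the loss with respect to the residual, and will become \<open>a - \<eta>\<close>. The
  remainder has factor \<open>l\<close> because the weights \<open>l * \<tau>\<close> and
  \<open>l * (1 - \<tau>)\<close> add up to it.\<close>

lemma reduced_objective_add_le:
  defines "b \<equiv> \<lambda>\<alpha> \<theta>. (2 * (l * \<tau>)) *\<^sub>R pos_part (residual Z Y \<alpha> \<theta>)
     - (2 * (l * (1 - \<tau>))) *\<^sub>R pos_part (- residual Z Y \<alpha> \<theta>)"
  shows "reduced_objective (\<alpha> + s, \<theta> + \<phi>) \<le> reduced_objective (\<alpha>, \<theta>)
     + (2 * (\<theta> \<bullet> \<phi>) - s * (b \<alpha> \<theta> \<bullet> 1) - (transpose Z *v b \<alpha> \<theta>) \<bullet> \<phi>)
     + (\<phi> \<bullet> \<phi> + l * (\<Sum>i\<in>UNIV. (s + \<phi> \<bullet> Z $ i)\<^sup>2))"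
proof -
  define r where "r = residual Z Y \<alpha> \<theta>"
  define h where "h i = s + \<phi> \<bullet> Z $ i" for i
  let ?q = "\<lambda>x. l * \<tau> * (max 0 x)\<^sup>2 + l * (1 - \<tau>) * (max 0 (- x))\<^sup>2"
  have q: "?q (r $ i - h i) \<le> ?q (r $ i) - b \<alpha> \<theta> $ i * h i + l * (h i)\<^sup>2" for i
  proof -
    have "l * \<tau> * (max 0 (r $ i - h i))\<^sup>2 \<le>
        l * \<tau> * ((max 0 (r $ i))\<^sup>2 - 2 * max 0 (r $ i) * h i + (h i)\<^sup>2)"
      using pos_part_square_add_le[of "r $ i" "- h i"] weights_pos
      by (intro mult_left_mono) auto
    moreover have "l * (1 - \<tau>) * (max 0 (- (r $ i - h i)))\<^sup>2 \<le>
        l * (1 - \<tau>) * ((max 0 (- r $ i))\<^sup>2 + 2 * max 0 (- r $ i) * h i + (h i)\<^sup>2)"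
      using pos_part_square_add_le[of "- r $ i" "h i"] weights_pos
      by (intro mult_left_mono) auto
    moreover have "b \<alpha> \<theta> $ i * h i =
        2 * (l * \<tau>) * max 0 (r $ i) * h i - 2 * (l * (1 - \<tau>)) * max 0 (- r $ i) * h i"
      by (simp add: b_def pos_part_def r_def left_diff_distrib)
    ultimately show ?thesis
      by (simp add: algebra_simps)
  qed
  have lin: "(\<Sum>i\<in>UNIV. b \<alpha> \<theta> $ i * h i) = s * (b \<alpha> \<theta> \<bullet> 1) + (transpose Z *v b \<alpha> \<theta>) \<bullet> \<phi>"
  proof -
    \<comment> \<open>The increment is minus the residual for zero responses, so
      \<open>inner_residual\<close> splits its product with \<open>b\<close>.\<close>
    have "(\<chi> i. h i) = - residual Z 0 s \<phi>"
      by (simp add: vec_eq_iff h_def residual_def)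
    moreover have "(\<Sum>i\<in>UNIV. b \<alpha> \<theta> $ i * h i) = b \<alpha> \<theta> \<bullet> (\<chi> i. h i)"
      by (simp add: inner_vec_def)
    ultimately show ?thesis
      by (simp add: inner_residual inner_commute)
  qed
  have "reduced_objective (\<alpha> + s, \<theta> + \<phi>) =
      (\<theta> + \<phi>) \<bullet> (\<theta> + \<phi>) + (\<Sum>i\<in>UNIV. ?q (r $ i - h i))"
    unfolding reduced_objective_def fst_conv snd_conv residual_add r_def h_def ..
  also have "\<dots> \<le> (\<theta> + \<phi>) \<bullet> (\<theta> + \<phi>) +
      (\<Sum>i\<in>UNIV. ?q (r $ i) - b \<alpha> \<theta> $ i * h i + l * (h i)\<^sup>2)"
    by (intro add_left_mono sum_mono q)
  also have "\<dots> = reduced_objective (\<alpha>, \<theta>)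
      + (2 * (\<theta> \<bullet> \<phi>) - (\<Sum>i\<in>UNIV. b \<alpha> \<theta> $ i * h i)) + (\<phi> \<bullet> \<phi> + l * (\<Sum>i\<in>UNIV. (h i)\<^sup>2))"
    unfolding reduced_objective_def fst_conv snd_conv r_def[symmetric]
    by (simp add: sum.distrib sum_subtractf sum_distrib_left inner_add_left inner_add_right
        inner_commute)
  finally show ?thesis
    unfolding lin unfolding h_def by linarith
qed

text \<open>The slacks are the positive and negative parts of the residual at a reduced minimizer,
  and the multipliers are their weighted copies. The last two clauses serve the uniqueness of
  \<open>\<alpha>\<close>.\<close>

lemma kkt_point_exists:
  obtains \<alpha> \<theta> \<xi>p \<xi>m a \<eta> where
    "primal_feasible Z Y (\<alpha>, \<theta>, \<xi>p, \<xi>m)" "dual_feasible (a, \<eta>)"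
    "P (\<alpha>, \<theta>, \<xi>p, \<xi>m) = D (a, \<eta>)"
    "\<And>i. residual Z Y \<alpha> \<theta> $ i = \<xi>p $ i - \<xi>m $ i"
    "\<And>i. \<xi>p $ i = 0 \<or> \<xi>m $ i = 0"
proof -
  obtain \<alpha> \<theta> where min: "\<And>y. reduced_objective (\<alpha>, \<theta>) \<le> reduced_objective y"
    by (metis reduced_minimizer_exists surj_pair)
  define r where "r = residual Z Y \<alpha> \<theta>"
  define a where "a = (2 * (l * \<tau>)) *\<^sub>R pos_part r"
  define \<eta> where "\<eta> = (2 * (l * (1 - \<tau>))) *\<^sub>R pos_part (- r)"
  let ?b = "a - \<eta>"
  \<comment> \<open>The minimizer is perturbed along the line \<open>t * (s, \<phi>)\<close>; the
    expansion becomes a nonnegative quadratic in \<open>t\<close> without constant term.\<close>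
  have first_order: "2 * (\<theta> \<bullet> \<phi>) - s * (?b \<bullet> 1) - (transpose Z *v ?b) \<bullet> \<phi> = 0" for s \<phi>
  proof (rule linear_coefficient_zero)
    fix t :: real
    have "0 \<le> (2 * (\<theta> \<bullet> (t *\<^sub>R \<phi>)) - t * s * (?b \<bullet> 1) - (transpose Z *v ?b) \<bullet> (t *\<^sub>R \<phi>))
        + ((t *\<^sub>R \<phi>) \<bullet> (t *\<^sub>R \<phi>) + l * (\<Sum>i\<in>UNIV. (t * s + (t *\<^sub>R \<phi>) \<bullet> Z $ i)\<^sup>2))"
      using min[of "(\<alpha> + t * s, \<theta> + t *\<^sub>R \<phi>)"]
        reduced_objective_add_le[of \<alpha> "t * s" \<theta> "t *\<^sub>R \<phi>"]
      unfolding a_def \<eta>_def r_def by linarith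
    also have "(\<Sum>i\<in>UNIV. (t * s + (t *\<^sub>R \<phi>) \<bullet> Z $ i)\<^sup>2) = t\<^sup>2 * (\<Sum>i\<in>UNIV. (s + \<phi> \<bullet> Z $ i)\<^sup>2)"
      unfolding sum_distrib_left by (intro sum.cong) (auto simp: power2_eq_square algebra_simps)
    finally show "0 \<le> t * (2 * (\<theta> \<bullet> \<phi>) - s * (?b \<bullet> 1) - (transpose Z *v ?b) \<bullet> \<phi>)
        + t\<^sup>2 * (\<phi> \<bullet> \<phi> + l * (\<Sum>i\<in>UNIV. (s + \<phi> \<bullet> Z $ i)\<^sup>2))"
      by (simp add: power2_eq_square algebra_simps)
  qed
  \<comment> \<open>The positional arguments are \<open>\<phi>\<close> and then \<open>s\<close>:
    here only \<open>\<alpha>\<close> moves.\<close>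
  have bal: "?b \<bullet> 1 = 0"
    using first_order[of 0 1] by simp
  define e where "e = 2 *\<^sub>R \<theta> - transpose Z *v ?b"
  \<comment> \<open>The direction is the gradient \<open>e\<close> in \<open>\<theta>\<close>
    itself, with \<open>\<alpha>\<close> fixed.\<close>
  have "e \<bullet> e = 0"
    using first_order[of e 0] by (simp add: e_def inner_diff_left)
  then have \<theta>: "\<theta> = (1 / 2) *\<^sub>R (transpose Z *v ?b)"
    by (simp add: e_def vec_eq_iff mult.commute)
  have d: "dual_feasible (a, \<eta>)"
    using weights_pos bal
    by (auto simp: dual_feasible_def a_def \<eta>_def less_eq_vec_def pos_part_def)
  have ap: "(1 / (2 * (l * \<tau>))) *\<^sub>R a = pos_part r"
    and \<eta>m: "(1 / (2 * (l * (1 - \<tau>)))) *\<^sub>R \<eta> = pos_part (- r)"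
    using weights_pos by (auto simp: a_def \<eta>_def)
  have slack: "a $ i * (pos_part r $ i - residual Z Y \<alpha> \<theta> $ i) = 0"
    "\<eta> $ i * (pos_part (- r) $ i + residual Z Y \<alpha> \<theta> $ i) = 0" for i
    by (auto simp: a_def \<eta>_def r_def pos_part_def max_def)
  show thesis
  proof
    show "primal_feasible Z Y (\<alpha>, \<theta>, pos_part r, pos_part (- r))"
      by (auto simp: primal_feasible_iff r_def[symmetric] pos_part_def max_def)
    show "dual_feasible (a, \<eta>)" by (fact d)
    show "P (\<alpha>, \<theta>, pos_part r, pos_part (- r)) = D (a, \<eta>)"
      unfolding duality_gap[OF d] ap \<eta>m slack using \<theta> by simp
    show "residual Z Y \<alpha> \<theta> $ i = pos_part r $ i - pos_part (- r) $ i"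
      "pos_part r $ i = 0 \<or> pos_part (- r) $ i = 0" for i
      by (auto simp: r_def pos_part_def max_def)
  qed
qed

section \<open>Uniqueness of the optima and recovery of \<open>\<theta>\<close>\<close>

text \<open>By weak duality the common value of the pair above is optimal on both sides, so any
  primal and any dual optimum have zero gap. The equality case of \<open>weak_duality\<close> then
  compares them with the fixed pair.\<close>

lemma primal_dual_optimal:
  "\<exists>!w. is_arg_min P (primal_feasible Z Y) w" (is ?primal)
  "\<exists>!d. is_arg_max D dual_feasible d" (is ?dual)
  "is_arg_min P (primal_feasible Z Y) (\<alpha>', \<theta>', \<xi>p', \<xi>m') \<Longrightarrow> is_arg_max D dual_feasible (a', \<eta>') \<Longrightarrow>
    \<theta>' = (1 / 2) *\<^sub>R (transpose Z *v (a' - \<eta>'))"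
proof -
  obtain \<alpha> \<theta> \<xi>p \<xi>m a \<eta> where w: "primal_feasible Z Y (\<alpha>, \<theta>, \<xi>p, \<xi>m)"
    and d: "dual_feasible (a, \<eta>)" and gap: "P (\<alpha>, \<theta>, \<xi>p, \<xi>m) = D (a, \<eta>)"
    and r: "\<And>i. residual Z Y \<alpha> \<theta> $ i = \<xi>p $ i - \<xi>m $ i"
    and compl: "\<And>i. \<xi>p $ i = 0 \<or> \<xi>m $ i = 0"
    using kkt_point_exists by blast
  have min_iff: "is_arg_min P (primal_feasible Z Y) x \<longleftrightarrow> primal_feasible Z Y x \<and> P x = D (a, \<eta>)" for x
  proof -
    have "D (a, \<eta>) \<le> P y" if "primal_feasible Z Y y" for y
      using weak_duality(1)[OF _ d] that by (cases y) auto
    then show ?thesis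
      using w gap unfolding is_arg_min_linorder by (metis order_antisym order_refl)
  qed
  have max_iff: "is_arg_max D dual_feasible x \<longleftrightarrow> dual_feasible x \<and> D x = D (a, \<eta>)" for x
  proof -
    have "D y \<le> D (a, \<eta>)" if "dual_feasible y" for y
      using weak_duality(1)[OF w, of "fst y" "snd y"] that gap by simp
    then show ?thesis
      using d unfolding is_arg_max_linorder by (metis order_antisym order_refl)
  qed
  note opt = weak_duality(2)[OF w d gap]
  show ?primal
  proof (rule ex1I)
    show "is_arg_min P (primal_feasible Z Y) (\<alpha>, \<theta>, \<xi>p, \<xi>m)"
      using w gap by (simp add: min_iff)
    fix x assume x: "is_arg_min P (primal_feasible Z Y) x"
    obtain \<alpha>' \<theta>' \<xi>p' \<xi>m' where x_eq: "x = (\<alpha>', \<theta>', \<xi>p', \<xi>m')"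
      by (metis prod.exhaust)
    have w': "primal_feasible Z Y (\<alpha>', \<theta>', \<xi>p', \<xi>m')" and gap': "P (\<alpha>', \<theta>', \<xi>p', \<xi>m') = D (a, \<eta>)"
      using x by (auto simp: min_iff x_eq)
    note opt' = weak_duality(2)[OF w' d gap']
    \<comment> \<open>The same dual point determines all primal components except
      \<open>\<alpha>\<close>, which is read off from one coordinate of the residual.\<close>
    have same: "\<theta>' = \<theta>" "\<xi>p' = \<xi>p" "\<xi>m' = \<xi>m"
      using opt opt' weights_pos by auto
    fix i :: 'n
    have "residual Z Y \<alpha>' \<theta> $ i = \<xi>p $ i - \<xi>m $ i"
    \<comment> \<open>If both slacks vanish, feasibility squeezes the residual to zero. Otherwise a
      nonzero multiplier makes its constraint tight.\<close>
    proof (cases "\<xi>p $ i = 0 \<and> \<xi>m $ i = 0")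
      case True
      then show ?thesis
        using w' unfolding same primal_feasible_iff
        by (smt (verit, best))
    next
      case False
      then have "a $ i \<noteq> 0 \<and> \<xi>m $ i = 0 \<or> \<eta> $ i \<noteq> 0 \<and> \<xi>p $ i = 0"
        using compl[of i] opt weights_pos by auto
      then show ?thesis
        using opt' unfolding same by auto
    qed
    then have "\<alpha>' = \<alpha>"
      using r[of i] by (simp add: residual_def)
    then show "x = (\<alpha>, \<theta>, \<xi>p, \<xi>m)"
      by (simp add: x_eq same)
  qed
  show ?dual
  proof (rule ex1I)
    show "is_arg_max D dual_feasible (a, \<eta>)"
      using d by (simp add: max_iff)
    fix x assume "is_arg_max D dual_feasible x"
    then have "dual_feasible (fst x, snd x)" "P (\<alpha>, \<theta>, \<xi>p, \<xi>m) = D (fst x, snd x)"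
      by (auto simp: max_iff gap)
    \<comment> \<open>Both dual points are the same multiples of the fixed slacks
      \<open>\<xi>p\<close> and \<open>\<xi>m\<close>.\<close>
    then show "x = (a, \<eta>)"
      using weak_duality(2)[OF w, of "fst x" "snd x"] opt by (metis prod.collapse)
  qed
  assume "is_arg_min P (primal_feasible Z Y) (\<alpha>', \<theta>', \<xi>p', \<xi>m')" "is_arg_max D dual_feasible (a', \<eta>')"
  then show "\<theta>' = (1 / 2) *\<^sub>R (transpose Z *v (a' - \<eta>'))"
    using weak_duality(2)[of \<alpha>' \<theta>' \<xi>p' \<xi>m' a' \<eta>'] by (simp add: min_iff max_iff)
qed

end

text \<open>Duality is expressed twice: by partial maximization over \<open>u\<close>,
  \<open>v\<close>, and by identifying the solutions of the full Lagrangian dual. The unique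
  existence clauses justify speaking of the minimizer and of the argmax.\<close>

theorem theorem2:
  fixes X Z :: "real^'p^'n" and Y :: "real^'n" and \<tau> lam l :: real
  assumes "invertible (sample_cov X)"
    and "Z = standardized X"
    and "0 < \<tau>" and "\<tau> < 1"
    and "0 < lam" and "l = lam / real CARD('n)"
  shows
    "(\<exists>!w :: ('p, 'n) primal_point. is_arg_min (primal_objective l \<tau>) (primal_feasible Z Y) w) \<and>
     (\<forall>a \<eta>. 0 \<le> a \<and> 0 \<le> \<eta> \<longrightarrow>
        (SUP (u, v)\<in>{(u, v). 0 \<le> u \<and> 0 \<le> v}. lagrange_dual_fun l \<tau> Z Y a \<eta> u v) =
        (if (a - \<eta>) \<bullet> 1 = 0 then ereal (dual_objective l \<tau> Z Y (a, \<eta>)) else - \<infinity>)) \<and>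
     (\<forall>a \<eta> u v. is_lagrange_dual_solution l \<tau> Z Y a \<eta> u v \<longleftrightarrow>
        u = 0 \<and> v = 0 \<and> is_arg_max (dual_objective l \<tau> Z Y) dual_feasible (a, \<eta>)) \<and>
     (\<exists>!d. is_arg_max (dual_objective l \<tau> Z Y) dual_feasible d) \<and>
     (\<forall>\<alpha> \<theta> \<xi>p \<xi>m a \<eta>.
        is_arg_min (primal_objective l \<tau>) (primal_feasible Z Y) (\<alpha>, \<theta>, \<xi>p, \<xi>m) \<longrightarrow>
        is_arg_max (dual_objective l \<tau> Z Y) dual_feasible (a, \<eta>) \<longrightarrow>
        \<theta> = (1 / 2) *\<^sub>R (transpose Z *v (a - \<eta>)))"
proof -
  interpret asymmetric_least_squares l \<tau> Z Y
    by unfold_locales (use assms in auto)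
  show ?thesis
    using SUP_lagrange_dual_fun is_lagrange_dual_solution_iff primal_dual_optimal by blast
qed

end
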